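(* Let $\Omega\subset\mathbb{R}^2$ be a bounded open set, let $\mu$ be a Radon measure on $\Omega$ with $\mu\in H^{-1}(\Omega)$, let $h_\mu\in H^1(\Omega)$ be stationary harmonic with $\Delta h_\mu=\mu$ in $\Omega$, and let $z_0\in\operatorname{supp}\mu$ be a zero of odd order of $\omega_{h_\mu}$ with $h_\mu(z_0)=0$. Let $V$ be a neighborhood of $z_0$, $H_1$ a multivalued harmonic function in $V$ with $|H_1|$ single-valued, and $\theta:V\to\{\pm1\}$ a function such that $h_\mu=\theta|H_1|$ in $V$, and let $n\ge1$ be an integer, $r>0$ and $\Phi:B(0,r)\to V$ a biholomorphism with $\Phi(0)=z_0$ and $H_1\circ\Phi(z)=\operatorname{Re}(z^{n+\frac12})$ for $z\in B(0,r)$. Then there exist $2n+1$ analytic curves $$\gamma_k:[0,1[\ \to V\qquad(k=1,2,\dots,2n+1)$$ such that $\gamma_k(0)=z_0$ and: 1) $\{z: H_1(z)=0\}\cap V=\bigcup_{k=1}^{2n+1}\gamma_k$, where $\gamma_k$ also denotes the set $\{\gamma_k(t):t\in[0,1[\}$; 2) $\operatorname{ang}(\gamma_k,\gamma_{k+1})=\frac{2\pi}{2n+1}$ for $k=1,\dots,2n+1$, where $\gamma_{2n+2}$ denotes $\gamma_1$ and $\operatorname{ang}(\gamma_k,\gamma_{k+1})$ is the angle between $\gamma_k$ and $\gamma_{k+1}$ at $z_0$; 3) there exists an analytic diffeomorphism $\phi:V\to B(0,1)$ such that $\phi\circ\gamma_k(t)=t\exp(i\theta_k)$ for $t\in[0,1[$,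 $k=1,\dots,2n+1$, where $\theta_k=\frac{\pi}{2n+1}+\frac{2(k-1)\pi}{2n+1}$.
   Context: $\mathbb{R}^2$ is identified with $\mathbb{C}$, and $B(0,r)=\{z\in\mathbb{C}:|z|<r\}$. Radon measures may be signed; the support of a measure is the complement of the largest open set on which it vanishes. $H^{-1}(\Omega)$ is the dual of $H^1_0(\Omega)$. The equation $\Delta h_\mu=\mu$ is in the sense of distributions. A function $h\in H^1(\Omega)$ is stationary harmonic if $\operatorname{div}T_h=0$ in $\Omega$ in the sense of distributions (row by row), where $$T_h=\begin{pmatrix}\frac12[(\partial_yh)^2-(\partial_xh)^2] & -\partial_xh\,\partial_yh\\ -\partial_xh\,\partial_yh&\frac12[(\partial_xh)^2-(\partial_yh)^2]\end{pmatrix};$$ equivalently, $\omega_h:=(\partial_xh)^2-(\partial_yh)^2-2i\,\partial_xh\,\partial_yh=(\partial_xh-i\partial_yh)^2$ is (a.e. equal to) a holomorphic function in $\Omega$, with which it is identified. Such an $h$ is identified with its continuous representative. Multivalued functions here are single-valued up to a sign, with prototype $z\mapsto z^{1/2}$: a multivalued harmonic function $H_1$ in $V$ (branched at $z_0$) assigns to each $z\in V$ a pair $\{u,-u\}$ of real numbers such that on each simply connected open subset of $V\setminus\{z_0\}$ it is of the form $\{\tilde H,-\tilde H\}$ with $\tilde H$ harmonic. Then $|H_1|$ and the zero set of $H_1$ are well defined. Similarly $\operatorname{Re}(z^{n+1/2})=\pm\rho^{\,n+1/2}\cos((n+\tfrac12)\varphi)$ for $z=\rho e^{i\varphi}$,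 and identities between multivalued functions are up to sign. *)

theory Defs
  imports "HOL-Complex_Analysis.Complex_Analysis"
begin

(* The plane R^2 is the type complex: 1 and \<i> are the coordinate directions, and a vector
   (a, b) is Complex a b, so that the inner product \<bullet> is the Euclidean one. *)

section \<open>Differentiable functions, test functions\<close>

definition partial :: "complex \<Rightarrow> (complex \<Rightarrow> real) \<Rightarrow> complex \<Rightarrow> real" where
  "partial v f z = frechet_derivative f (at z) v"

definition grad :: "(complex \<Rightarrow> real) \<Rightarrow> complex \<Rightarrow> complex" where
  "grad f z = Complex (partial 1 f z) (partial \<i> f z)"

definition laplacian :: "(complex \<Rightarrow> real) \<Rightarrow> complex \<Rightarrow> real" where
  "laplacian f z = partial 1 (partial 1 f) z + partial \<i> (partial \<i> f) z"

primrec C_k_on :: "nat \<Rightarrow> complex set \<Rightarrow> (complex \<Rightarrow> real) \<Rightarrow> bool" where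
  "C_k_on 0 U f \<longleftrightarrow> continuous_on U f"
| "C_k_on (Suc k) U f \<longleftrightarrow>
     (\<forall>z\<in>U. f differentiable (at z)) \<and> (\<forall>v. C_k_on k U (partial v f))"

definition harmonic_on :: "complex set \<Rightarrow> (complex \<Rightarrow> real) \<Rightarrow> bool" where
  "harmonic_on U f \<longleftrightarrow> C_k_on 2 U f \<and> (\<forall>z\<in>U. laplacian f z = 0)"

definition test_functions :: "complex set \<Rightarrow> (complex \<Rightarrow> real) set" where
  "test_functions \<Omega> = {\<phi>. (\<forall>k. C_k_on k UNIV \<phi>) \<and>
     compact (closure {z. \<phi> z \<noteq> 0}) \<and> closure {z. \<phi> z \<noteq> 0} \<subseteq> \<Omega>}"

section \<open>Sobolev spaces\<close>

text \<open>Elements of the function spaces are represented by functions on the whole plane whose values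
  outside \<open>\<Omega>\<close> are irrelevant, and which are only significant up to almost everywhere equality.\<close>

definition L2 :: "complex set \<Rightarrow> (complex \<Rightarrow> real) set" where
  "L2 \<Omega> = {f \<in> borel_measurable (lebesgue_on \<Omega>). integrable (lebesgue_on \<Omega>) (\<lambda>z. (f z)\<^sup>2)}"

definition is_weak_deriv ::
    "complex set \<Rightarrow> complex \<Rightarrow> (complex \<Rightarrow> real) \<Rightarrow> (complex \<Rightarrow> real) \<Rightarrow> bool" where
  "is_weak_deriv \<Omega> v u g \<longleftrightarrow> (\<forall>\<phi>\<in>test_functions \<Omega>.
     (LINT z|lebesgue_on \<Omega>. u z * partial v \<phi> z) = - (LINT z|lebesgue_on \<Omega>. g z * \<phi> z))"

definition sobolev_H1 :: "complex set \<Rightarrow> (complex \<Rightarrow> real) set" where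
  "sobolev_H1 \<Omega> = {u \<in> L2 \<Omega>. \<forall>v\<in>{1, \<i>}. \<exists>g\<in>L2 \<Omega>. is_weak_deriv \<Omega> v u g}"

text \<open>The choice made here is immaterial: the weak derivatives in direction \<open>v\<close> of a given
  function agree almost everywhere in \<open>\<Omega>\<close>.\<close>

definition weak_deriv :: "complex set \<Rightarrow> complex \<Rightarrow> (complex \<Rightarrow> real) \<Rightarrow> complex \<Rightarrow> real" where
  "weak_deriv \<Omega> v u = (SOME g. g \<in> L2 \<Omega> \<and> is_weak_deriv \<Omega> v u g)"

definition H1_norm :: "complex set \<Rightarrow> (complex \<Rightarrow> real) \<Rightarrow> real" where
  "H1_norm \<Omega> u = sqrt ((LINT z|lebesgue_on \<Omega>. (u z)\<^sup>2)
     + (LINT z|lebesgue_on \<Omega>. (weak_deriv \<Omega> 1 u z)\<^sup>2)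
     + (LINT z|lebesgue_on \<Omega>. (weak_deriv \<Omega> \<i> u z)\<^sup>2))"

definition sobolev_H10 :: "complex set \<Rightarrow> (complex \<Rightarrow> real) set" where
  "sobolev_H10 \<Omega> = {u \<in> sobolev_H1 \<Omega>. \<exists>\<phi>. (\<forall>j. \<phi> j \<in> test_functions \<Omega>) \<and>
     (\<lambda>j::nat. H1_norm \<Omega> (\<lambda>z. u z - \<phi> j z)) \<longlonglongrightarrow> 0}"

section \<open>Signed Radon measures\<close>

text \<open>A signed Radon measure need not be defined as a number on all Borel sets (both its positive
  and its negative part may be infinite). It is given here by a pair of positive Radon measures
  on \<open>\<Omega>\<close> and stands for their difference. On an open subset of the plane every Borel measure that
  is finite on compact sets is regular.\<close>

type_synonym signed_measure = "complex measure \<times> complex measure"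

definition positive_radon :: "complex set \<Rightarrow> complex measure \<Rightarrow> bool" where
  "positive_radon \<Omega> M \<longleftrightarrow> sets M = sets (restrict_space borel \<Omega>) \<and>
     (\<forall>K. compact K \<and> K \<subseteq> \<Omega> \<longrightarrow> emeasure M K < \<infinity>)"

definition radon :: "complex set \<Rightarrow> signed_measure \<Rightarrow> bool" where
  "radon \<Omega> \<mu> \<longleftrightarrow> positive_radon \<Omega> (fst \<mu>) \<and> positive_radon \<Omega> (snd \<mu>)"

definition signed_integral :: "signed_measure \<Rightarrow> (complex \<Rightarrow> real) \<Rightarrow> real" where
  "signed_integral \<mu> \<phi> = (LINT z|fst \<mu>. \<phi> z) - (LINT z|snd \<mu>. \<phi> z)"

definition vanishes_on :: "signed_measure \<Rightarrow> complex set \<Rightarrow> bool" where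
  "vanishes_on \<mu> U \<longleftrightarrow>
     (\<forall>A. A \<in> sets borel \<and> A \<subseteq> U \<longrightarrow> emeasure (fst \<mu>) A = emeasure (snd \<mu>) A)"

definition supp :: "complex set \<Rightarrow> signed_measure \<Rightarrow> complex set" where
  "supp \<Omega> \<mu> = \<Omega> - \<Union>{U. open U \<and> U \<subseteq> \<Omega> \<and> vanishes_on \<mu> U}"

text \<open>Membership in the dual of \<open>sobolev_H10\<close>: integration of test functions extends to a bounded
  linear functional.\<close>

definition in_H_minus1 :: "complex set \<Rightarrow> signed_measure \<Rightarrow> bool" where
  "in_H_minus1 \<Omega> \<mu> \<longleftrightarrow> (\<exists>L C.
     (\<forall>u\<in>sobolev_H10 \<Omega>. \<forall>v\<in>sobolev_H10 \<Omega>. \<forall>a b.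
        L (\<lambda>z. a * u z + b * v z) = a * L u + b * L v) \<and>
     (\<forall>u\<in>sobolev_H10 \<Omega>. \<bar>L u\<bar> \<le> C * H1_norm \<Omega> u) \<and>
     (\<forall>\<phi>\<in>test_functions \<Omega>. L \<phi> = signed_integral \<mu> \<phi>))"

definition distr_laplacian_eq :: "complex set \<Rightarrow> (complex \<Rightarrow> real) \<Rightarrow> signed_measure \<Rightarrow> bool" where
  "distr_laplacian_eq \<Omega> h \<mu> \<longleftrightarrow> (\<forall>\<phi>\<in>test_functions \<Omega>.
     (LINT z|lebesgue_on \<Omega>. h z * laplacian \<phi> z) = signed_integral \<mu> \<phi>)"

section \<open>Stationary harmonic functions\<close>

definition distr_div_zero :: "complex set \<Rightarrow> (complex \<Rightarrow> complex) \<Rightarrow> bool" where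
  "distr_div_zero \<Omega> F \<longleftrightarrow>
     (\<forall>\<phi>\<in>test_functions \<Omega>. (LINT z|lebesgue_on \<Omega>. F z \<bullet> grad \<phi> z) = 0)"

text \<open>The two rows of the stress-energy tensor \<open>T\<^sub>h\<close>.\<close>

definition stress_row1 :: "complex set \<Rightarrow> (complex \<Rightarrow> real) \<Rightarrow> complex \<Rightarrow> complex" where
  "stress_row1 \<Omega> h z = Complex
     (1/2 * ((weak_deriv \<Omega> \<i> h z)\<^sup>2 - (weak_deriv \<Omega> 1 h z)\<^sup>2))
     (- weak_deriv \<Omega> 1 h z * weak_deriv \<Omega> \<i> h z)"

definition stress_row2 :: "complex set \<Rightarrow> (complex \<Rightarrow> real) \<Rightarrow> complex \<Rightarrow> complex" where
  "stress_row2 \<Omega> h z = Complex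
     (- weak_deriv \<Omega> 1 h z * weak_deriv \<Omega> \<i> h z)
     (1/2 * ((weak_deriv \<Omega> 1 h z)\<^sup>2 - (weak_deriv \<Omega> \<i> h z)\<^sup>2))"

definition stationary_harmonic :: "complex set \<Rightarrow> (complex \<Rightarrow> real) \<Rightarrow> bool" where
  "stationary_harmonic \<Omega> h \<longleftrightarrow> h \<in> sobolev_H1 \<Omega> \<and>
     distr_div_zero \<Omega> (stress_row1 \<Omega> h) \<and> distr_div_zero \<Omega> (stress_row2 \<Omega> h)"

definition hopf :: "complex set \<Rightarrow> (complex \<Rightarrow> real) \<Rightarrow> complex \<Rightarrow> complex" where
  "hopf \<Omega> h z = (of_real (weak_deriv \<Omega> 1 h z) - \<i> * of_real (weak_deriv \<Omega> \<i> h z))\<^sup>2"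

text \<open>Order of vanishing at \<open>z\<^sub>0\<close> of the holomorphic representative of \<open>\<omega>\<^sub>h\<close>.
  The constant \<open>zorder\<close> is meaningful only if the function does not vanish
  identically near the point.\<close>

definition hopf_odd_zero :: "complex set \<Rightarrow> (complex \<Rightarrow> real) \<Rightarrow> complex \<Rightarrow> bool" where
  "hopf_odd_zero \<Omega> h z\<^sub>0 \<longleftrightarrow> (\<exists>w. w holomorphic_on \<Omega> \<and>
     (AE z in lebesgue_on \<Omega>. hopf \<Omega> h z = w z) \<and>
     w z\<^sub>0 = 0 \<and> \<not> (\<forall>\<^sub>F z in nhds z\<^sub>0. w z = 0) \<and> odd (zorder w z\<^sub>0))"

section \<open>Multivalued harmonic functions\<close>

definition multivalued_harmonic ::
    "complex set \<Rightarrow> complex \<Rightarrow> (complex \<Rightarrow> real set) \<Rightarrow> bool" where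
  "multivalued_harmonic V z\<^sub>0 H \<longleftrightarrow> (\<forall>z\<in>V. \<exists>u. H z = {u, - u}) \<and>
     (\<forall>U. open U \<and> simply_connected U \<and> U \<subseteq> V - {z\<^sub>0} \<longrightarrow>
        (\<exists>G. harmonic_on U G \<and> (\<forall>z\<in>U. H z = {G z, - G z})))"

definition abs_single_valued_on :: "complex set \<Rightarrow> (complex \<Rightarrow> real set) \<Rightarrow> bool" where
  "abs_single_valued_on V H \<longleftrightarrow> (\<forall>z\<in>V. is_singleton (abs ` H z))"

definition mv_abs :: "(complex \<Rightarrow> real set) \<Rightarrow> complex \<Rightarrow> real" where
  "mv_abs H z = the_elem (abs ` H z)"

text \<open>The multivalued function \<open>Re (z\<^bsup>n+1/2\<^esup>)\<close>: replacing \<open>Arg z\<close> by another argument of \<open>z\<close> changes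
  at most the sign.\<close>

definition mv_Re_half_power :: "nat \<Rightarrow> complex \<Rightarrow> real set" where
  "mv_Re_half_power n z =
     (let u = cmod z powr (real n + 1/2) * cos ((real n + 1/2) * Arg z) in {u, - u})"

definition biholomorphism :: "(complex \<Rightarrow> complex) \<Rightarrow> complex set \<Rightarrow> complex set \<Rightarrow> bool" where
  "biholomorphism f A B \<longleftrightarrow>
     f holomorphic_on A \<and> bij_betw f A B \<and> inv_into A f holomorphic_on B"

section \<open>Analytic curves and diffeomorphisms\<close>

text \<open>Real analyticity: near every point of \<open>S\<close>, \<open>f\<close> is the sum of a power series in the coordinates
  (the multi-indices are the functions \<open>Basis \<rightarrow>\<^sub>E UNIV\<close>). If \<open>S\<close> is not open, this means that \<open>f\<close>
  is locally the restriction of an analytic function to \<open>S\<close>.\<close>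

definition real_analytic_on ::
    "('a::euclidean_space \<Rightarrow> 'b::real_normed_vector) \<Rightarrow> 'a set \<Rightarrow> bool" where
  "real_analytic_on f S \<longleftrightarrow> (\<forall>a\<in>S. \<exists>e>0. \<exists>c :: ('a \<Rightarrow> nat) \<Rightarrow> 'b. \<forall>x\<in>ball a e.
     (\<lambda>\<alpha>. (\<Prod>b\<in>Basis. ((x - a) \<bullet> b) ^ \<alpha> b) *\<^sub>R c \<alpha>) summable_on (Basis \<rightarrow>\<^sub>E UNIV) \<and>
     (x \<in> S \<longrightarrow> f x = (\<Sum>\<^sub>\<infinity>\<alpha>\<in>Basis \<rightarrow>\<^sub>E UNIV. (\<Prod>b\<in>Basis. ((x - a) \<bullet> b) ^ \<alpha> b) *\<^sub>R c \<alpha>)))"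

definition analytic_diffeomorphism ::
    "(complex \<Rightarrow> complex) \<Rightarrow> complex set \<Rightarrow> complex set \<Rightarrow> bool" where
  "analytic_diffeomorphism f A B \<longleftrightarrow>
     real_analytic_on f A \<and> bij_betw f A B \<and> real_analytic_on (inv_into A f) B"

text \<open>The two curves have nonzero (one-sided) tangent vectors at their common starting point,
  and these form the unoriented angle \<open>\<alpha>\<close>.\<close>

definition has_angle :: "(real \<Rightarrow> complex) \<Rightarrow> (real \<Rightarrow> complex) \<Rightarrow> real \<Rightarrow> bool" where
  "has_angle c d \<alpha> \<longleftrightarrow> c 0 = d 0 \<and> (\<exists>v w.
     (c has_vector_derivative v) (at 0 within {0..<1}) \<and>
     (d has_vector_derivative w) (at 0 within {0..<1}) \<and>
     v \<noteq> 0 \<and> w \<noteq> 0 \<and> \<alpha> = arccos ((v \<bullet> w) / (norm v * norm w)))"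

end

theory Submission
  imports Defs
begin

text \<open>In the coordinate \<open>\<Phi>\<close> everything is explicit. The zeros of
  \<open>\<rho>\<^bsup>n+1/2\<^esup> cos ((n + 1/2) \<phi>)\<close> are the origin and the points whose direction \<open>w\<close> satisfies
  \<open>w\<^bsup>2n+1\<^esup> = -1\<close>; there are \<open>2n+1\<close> such directions, at equal angles, so the zero set in the disc
  \<open>B(0,r)\<close> is a union of \<open>2n+1\<close> radii (\<open>half_power_zero_iff\<close>). The curves are the
  \<open>\<Phi>\<close>-images of these radii, and the straightening map is \<open>\<Phi>\<^sup>-\<^sup>1 / r\<close>. Since \<open>\<Phi>\<close> is injective and
  holomorphic, \<open>\<Phi>'(0) \<noteq> 0\<close>, so the curves have tangents at \<open>z\<^sub>0\<close> and the angles between the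
  radii are preserved (\<open>arccos_inner_rotated\<close>).

  What remains is that holomorphic functions are real analytic as functions of two real
  variables, and so are their restrictions to the real line. The second claim is a mere reading of
  the Taylor series. For the first, each term \<open>(p + \<i> q)\<^sup>m\<close> of the Taylor series is expanded by the
  binomial theorem; the resulting double series converges absolutely when \<open>\<bar>p\<bar> + \<bar>q\<bar>\<close> is less
  than the radius of convergence, which is ensured on a disc of half that radius.\<close>

section \<open>Holomorphic functions are real analytic\<close>

lemma holomorphic_taylor_abs_summable:
  assumes f: "f holomorphic_on ball a R" and s: "0 \<le> s" "s < R"
  shows "summable (\<lambda>m. norm ((deriv ^^ m) f a / fact m) * s ^ m)"
proof -
  obtain s' where s': "s < s'" "s' < R"
    using dense s by blast
  then have "a + of_real s' \<in> ball a R"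
    using s by (simp add: dist_norm)
  from sums_summable[OF holomorphic_power_series[OF f this]]
  have "summable (\<lambda>m. (deriv ^^ m) f a / fact m * of_real s' ^ m)"
    by simp
  then have "summable (\<lambda>m. norm ((deriv ^^ m) f a / fact m * of_real s ^ m))"
    by (rule powser_insidea) (use s s' in auto)
  then show ?thesis
    using s by (simp add: norm_mult norm_divide norm_power)
qed

lemma holomorphic_taylor_has_sum:
  assumes f: "f holomorphic_on ball a R" and x: "x \<in> ball a R"
  shows "((\<lambda>m. (deriv ^^ m) f a / fact m * (x - a) ^ m) has_sum f x) UNIV"
proof (rule norm_summable_imp_has_sum)
  show "summable (\<lambda>m. norm ((deriv ^^ m) f a / fact m * (x - a) ^ m))"
    using holomorphic_taylor_abs_summable[OF f, of "norm (x - a)"] x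
    by (simp add: norm_mult norm_divide norm_power dist_norm norm_minus_commute)
  show "(\<lambda>m. (deriv ^^ m) f a / fact m * (x - a) ^ m) sums f x"
    by (rule holomorphic_power_series[OF f x])
qed

lemma real_analytic_on_of_real:
  assumes "f holomorphic_on U" "open U" "of_real ` S \<subseteq> U"
  shows "real_analytic_on (\<lambda>t::real. f (of_real t)) S"
  unfolding real_analytic_on_def
proof
  fix a assume "a \<in> S"
  then have "complex_of_real a \<in> U"
    using assms(3) by auto
  then obtain e where e: "e > 0" "ball (complex_of_real a) e \<subseteq> U"
    using openE[OF assms(2)] by metis
  have f: "f holomorphic_on ball (complex_of_real a) e"
    using assms(1) e(2) holomorphic_on_subset by blast
  define c where "c \<alpha> = (deriv ^^ \<alpha> 1) f (of_real a) / fact (\<alpha> 1)" for \<alpha> :: "real \<Rightarrow> nat"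
  have *: "((\<lambda>\<alpha>. (\<Prod>b\<in>Basis. ((x - a) \<bullet> b) ^ \<alpha> b) *\<^sub>R c \<alpha>) has_sum f (of_real x))
      (Basis \<rightarrow>\<^sub>E UNIV)" if "x \<in> ball a e" for x
  proof -
    have "complex_of_real x \<in> ball (of_real a) e"
      using that by (simp add: dist_of_real)
    note taylor = holomorphic_taylor_has_sum[OF f this]
    have "((\<lambda>\<alpha>. (\<Prod>b\<in>Basis. ((x - a) \<bullet> b) ^ \<alpha> b) *\<^sub>R c \<alpha>) has_sum f (of_real x))
        (Basis \<rightarrow>\<^sub>E UNIV) \<longleftrightarrow>
      ((\<lambda>m. (deriv ^^ m) f (of_real a) / fact m * (of_real x - of_real a) ^ m)
        has_sum f (of_real x)) UNIV"
      by (rule has_sum_reindex_bij_witness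
          [where i = "\<lambda>m. \<lambda>b\<in>Basis. m" and j = "\<lambda>\<alpha>. \<alpha> 1"])
        (auto simp: c_def scaleR_conv_of_real PiE_def extensional_def fun_eq_iff)
    with taylor show ?thesis
      by blast
  qed
  show "\<exists>e>0. \<exists>c :: (real \<Rightarrow> nat) \<Rightarrow> complex. \<forall>x\<in>ball a e.
     (\<lambda>\<alpha>. (\<Prod>b\<in>Basis. ((x - a) \<bullet> b) ^ \<alpha> b) *\<^sub>R c \<alpha>) summable_on (Basis \<rightarrow>\<^sub>E UNIV) \<and>
     (x \<in> S \<longrightarrow> f (of_real x) =
        (\<Sum>\<^sub>\<infinity>\<alpha>\<in>Basis \<rightarrow>\<^sub>E UNIV. (\<Prod>b\<in>Basis. ((x - a) \<bullet> b) ^ \<alpha> b) *\<^sub>R c \<alpha>))"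
    proof (intro exI conjI ballI impI)
    fix x assume x: "x \<in> ball a e"
    show "(\<lambda>\<alpha>. (\<Prod>b\<in>Basis. ((x - a) \<bullet> b) ^ \<alpha> b) *\<^sub>R c \<alpha>) summable_on (Basis \<rightarrow>\<^sub>E UNIV)"
      using *[OF x] by (rule has_sum_imp_summable)
    show "f (of_real x) =
        (\<Sum>\<^sub>\<infinity>\<alpha>\<in>Basis \<rightarrow>\<^sub>E UNIV. (\<Prod>b\<in>Basis. ((x - a) \<bullet> b) ^ \<alpha> b) *\<^sub>R c \<alpha>)"
      using *[OF x] by (rule infsumI[symmetric])
  qed (use e(1) in simp)
qed

text \<open>The absolute values of the terms of degree \<open>m\<close> of the double series add up to
  \<open>\<bar>a\<^sub>m\<bar> (\<bar>p\<bar> + \<bar>q\<bar>)\<^sup>m\<close>, and the terms themselves to \<open>a\<^sub>m (p + \<i> q)\<^sup>m\<close>; both are the binomial theorem.\<close>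

lemma has_sum_binomial_expansion:
  fixes a :: "nat \<Rightarrow> complex" and p q :: real
  assumes sm: "summable (\<lambda>m. norm (a m) * (\<bar>p\<bar> + \<bar>q\<bar>) ^ m)"
    and L: "((\<lambda>m. a m * Complex p q ^ m) has_sum L) UNIV"
  shows "((\<lambda>(m, j). a m * of_nat (m choose j) * of_real p ^ j * (\<i> * of_real q) ^ (m - j))
    has_sum L) (SIGMA m:UNIV. {..m})"
proof -
  define g where
    "g m j = a m * of_nat (m choose j) * of_real p ^ j * (\<i> * of_real q) ^ (m - j)" for m j
  have inner: "(\<Sum>j\<le>m. g m j) = a m * Complex p q ^ m" for m
    by (simp add: g_def Complex_eq binomial_ring sum_distrib_left mult_ac)
  have inner_norm: "(\<Sum>j\<le>m. norm (g m j)) = norm (a m) * (\<bar>p\<bar> + \<bar>q\<bar>) ^ m" for m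
    by (simp add: g_def binomial_ring sum_distrib_left norm_mult norm_power mult_ac)
  have "(\<lambda>x. norm (case x of (m, j) \<Rightarrow> g m j)) summable_on (SIGMA m:UNIV. {..m})"
    unfolding Infinite_Sum.abs_summable_on_Sigma_iff
  proof (intro conjI ballI)
    show "(\<lambda>m. norm (\<Sum>\<^sub>\<infinity>j\<in>{..m}. norm (case (m, j) of (m, j) \<Rightarrow> g m j))) summable_on UNIV"
      using sm by (simp add: inner_norm summable_on_UNIV_nonneg_real_iff)
  qed auto
  then have s: "(\<lambda>(m, j). g m j) summable_on (SIGMA m:UNIV. {..m})"
    by (rule abs_summable_summable)
  have "infsum (\<lambda>(m, j). g m j) (SIGMA m:UNIV. {..m}) = (\<Sum>\<^sub>\<infinity>m. \<Sum>\<^sub>\<infinity>j\<in>{..m}. g m j)"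
    using infsum_Sigma'_banach[OF s] by simp
  also have "\<dots> = L"
    using L by (simp add: inner infsumI)
  finally show ?thesis
    using has_sum_infsum[OF s] by (simp add: g_def)
qed

lemma holomorphic_on_imp_real_analytic_on:
  assumes "f holomorphic_on S" "open S"
  shows "real_analytic_on f S"
  unfolding real_analytic_on_def
proof
  fix z assume "z \<in> S"
  then obtain R where R: "R > 0" "ball z R \<subseteq> S"
    using assms openE by blast
  have f: "f holomorphic_on ball z R"
    using assms(1) R(2) holomorphic_on_subset by blast
  define a where "a m = (deriv ^^ m) f z / fact m" for m
  define c where "c \<alpha> = a (\<alpha> 1 + \<alpha> \<i>) * of_nat ((\<alpha> 1 + \<alpha> \<i>) choose \<alpha> 1) * \<i> ^ \<alpha> \<i>"
    for \<alpha> :: "complex \<Rightarrow> nat"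
  have *: "((\<lambda>\<alpha>. (\<Prod>b\<in>Basis. ((x - z) \<bullet> b) ^ \<alpha> b) *\<^sub>R c \<alpha>) has_sum f x) (Basis \<rightarrow>\<^sub>E UNIV)"
    if x: "x \<in> ball z (R/2)" for x
  proof -
    define p where "p = Re (x - z)"
    define q where "q = Im (x - z)"
    have pq: "x - z = Complex p q"
      by (simp add: p_def q_def complex_eq_iff)
    \<comment> \<open>This is why the radius is halved: each of the two coordinates is below \<open>R/2\<close>.\<close>
    have "\<bar>p\<bar> + \<bar>q\<bar> < R"
      using abs_Re_le_cmod[of "x - z"] abs_Im_le_cmod[of "x - z"] x
      by (simp add: p_def q_def dist_norm norm_minus_commute)
    then have sm: "summable (\<lambda>m. norm (a m) * (\<bar>p\<bar> + \<bar>q\<bar>) ^ m)"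
      unfolding a_def by (intro holomorphic_taylor_abs_summable[OF f]) auto
    have "x \<in> ball z R"
      using x R(1) by auto
    from holomorphic_taylor_has_sum[OF f this]
    have "((\<lambda>m. a m * Complex p q ^ m) has_sum f x) UNIV"
      by (simp add: a_def pq)
    note expansion = has_sum_binomial_expansion[OF sm this]
    \<comment> \<open>A term is indexed by its degree and the exponent of \<open>p\<close> on one side, by the exponents of
      \<open>p\<close> and \<open>q\<close> on the other.\<close>
    have "((\<lambda>\<alpha>. (\<Prod>b\<in>Basis. ((x - z) \<bullet> b) ^ \<alpha> b) *\<^sub>R c \<alpha>) has_sum f x)
        (Basis \<rightarrow>\<^sub>E UNIV) \<longleftrightarrow>
      ((\<lambda>(m, j). a m * of_nat (m choose j) * of_real p ^ j * (\<i> * of_real q) ^ (m - j))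
        has_sum f x) (SIGMA m:UNIV. {..m})"
      by (rule has_sum_reindex_bij_witness
          [where i = "\<lambda>(m, j). \<lambda>b\<in>Basis. if b = 1 then j else m - j"
            and j = "\<lambda>\<alpha>. (\<alpha> 1 + \<alpha> \<i>, \<alpha> 1)"])
        (auto simp: c_def pq Basis_complex_def scaleR_conv_of_real power_mult_distrib
          PiE_def extensional_def fun_eq_iff)
    with expansion show ?thesis
      by blast
  qed
  show "\<exists>e>0. \<exists>c :: (complex \<Rightarrow> nat) \<Rightarrow> complex. \<forall>x\<in>ball z e.
     (\<lambda>\<alpha>. (\<Prod>b\<in>Basis. ((x - z) \<bullet> b) ^ \<alpha> b) *\<^sub>R c \<alpha>) summable_on (Basis \<rightarrow>\<^sub>E UNIV) \<and>
     (x \<in> S \<longrightarrow> f x =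
        (\<Sum>\<^sub>\<infinity>\<alpha>\<in>Basis \<rightarrow>\<^sub>E UNIV. (\<Prod>b\<in>Basis. ((x - z) \<bullet> b) ^ \<alpha> b) *\<^sub>R c \<alpha>))"
    proof (intro exI conjI ballI impI)
    fix x assume x: "x \<in> ball z (R/2)"
    show "(\<lambda>\<alpha>. (\<Prod>b\<in>Basis. ((x - z) \<bullet> b) ^ \<alpha> b) *\<^sub>R c \<alpha>) summable_on (Basis \<rightarrow>\<^sub>E UNIV)"
      using *[OF x] by (rule has_sum_imp_summable)
    show "f x =
        (\<Sum>\<^sub>\<infinity>\<alpha>\<in>Basis \<rightarrow>\<^sub>E UNIV. (\<Prod>b\<in>Basis. ((x - z) \<bullet> b) ^ \<alpha> b) *\<^sub>R c \<alpha>)"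
      using *[OF x] by (rule infsumI[symmetric])
  qed (use R(1) in simp)
qed

section \<open>The zero set of the half-integer power\<close>

definition zero_angle :: "nat \<Rightarrow> nat \<Rightarrow> real" where
  "zero_angle n k = pi / real (2*n+1) + 2 * (real k - 1) * pi / real (2*n+1)"

lemma zero_angle_Suc: "zero_angle n (k + 1) = zero_angle n k + 2 * pi / real (2*n+1)"
  unfolding zero_angle_def add.assoc
  by (simp only: add_divide_distrib[symmetric]) (simp add: algebra_simps)

lemma zero_angle_times: "real (2*n+1) * zero_angle n k = pi + 2 * (real k - 1) * pi"
  unfolding zero_angle_def add_divide_distrib[symmetric]
  by (rule nonzero_mult_div_cancel_left[THEN trans[OF times_divide_eq_right]]) simp

lemma zero_angle_unique:
  assumes "real (2*n+1) * t = pi + 2 * (real k - 1) * pi + real (2*n+1) * s"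
  shows "t = zero_angle n k + s"
proof -
  have "real (2*n+1) * t = real (2*n+1) * (zero_angle n k + s)"
    using assms by (simp only: distrib_left zero_angle_times)
  then show ?thesis
    by (simp only: mult_cancel_left of_nat_eq_0_iff) simp
qed

lemma cis_zero_angle_periodic: "cis (zero_angle n (k + (2*n+1))) = cis (zero_angle n k)"
proof -
  have "zero_angle n (k + (2*n+1)) = zero_angle n k + 2 * pi"
    by (rule zero_angle_unique, subst zero_angle_times) (simp add: algebra_simps)
  then show ?thesis
    by (simp flip: cis_mult)
qed

lemma cis_power_eq_minus_one_iff:
  "cis t ^ (2*n+1) = -1 \<longleftrightarrow> (\<exists>k\<in>{1..2*n+1}. cis t = cis (zero_angle n k))"
proof
  assume "\<exists>k\<in>{1..2*n+1}. cis t = cis (zero_angle n k)"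
  then obtain k where k: "k \<ge> 1" "cis t = cis (zero_angle n k)"
    by auto
  have "real (2*n+1) * zero_angle n k = pi + 2 * pi * of_int (int k - 1)"
    by (subst zero_angle_times) (simp add: algebra_simps)
  then show "cis t ^ (2*n+1) = -1"
    unfolding k(2) Complex.DeMoivre
    by (simp only: cis_mult[symmetric] cis_pi cis_multiple_2pi Ints_of_int mult_1_right)
next
  assume "cis t ^ (2*n+1) = -1"
  then have "cis (real (2*n+1) * t) = cis pi"
    by (simp only: Complex.DeMoivre cis_pi)
  then obtain i :: int where i: "real (2*n+1) * t = pi + 2 * pi * of_int i"
    using sin_cos_eq_iff[of "real (2*n+1) * t" pi] by (auto simp: complex_eq_iff)
  define N where "N = 2*n+1"
  \<comment> \<open>The directions are numbered from 1, so the residue of \<open>i\<close> is shifted by one.\<close>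
  define k where "k = nat (i mod int N) + 1"
  have "k \<in> {1..N}"
    by (simp add: k_def N_def nat_less_iff Suc_le_eq)
  moreover have "t = zero_angle n k + 2 * pi * of_int (i div int N)"
  proof -
    have "real_of_int i = of_int (i div int N) * real N + of_int (i mod int N)"
      by (metis div_mult_mod_eq of_int_add of_int_mult of_int_of_nat_eq)
    moreover have "real k - 1 = of_int (i mod int N)"
      by (simp add: k_def N_def)
    ultimately have "real N * t = pi + 2 * pi * (of_int (i div int N) * real N + (real k - 1))"
      using i by (simp add: N_def)
    then show ?thesis
      by (intro zero_angle_unique) (simp add: N_def algebra_simps)
  qed
  then have "cis t = cis (zero_angle n k)"
    by (simp only: cis_mult[symmetric] cis_multiple_2pi Ints_of_int mult_1_right)
  ultimately show "\<exists>k\<in>{1..2*n+1}. cis t = cis (zero_angle n k)"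
    unfolding N_def by blast
qed

text \<open>Doubling the angle removes the branch: \<open>cos ((n + 1/2) t) = 0\<close> exactly when
  \<open>cis ((2n + 1) t) = -1\<close>, a condition on the direction \<open>cis t\<close> alone.\<close>

lemma half_power_zero_iff:
  "mv_Re_half_power n z = {0} \<longleftrightarrow>
    (\<exists>k\<in>{1..2*n+1}. z = of_real (cmod z) * cis (zero_angle n k))"
proof (cases "z = 0")
  case True
  then show ?thesis
    by (auto simp: mv_Re_half_power_def)
next
  case False
  define t where "t = Arg z"
  define x where "x = (real n + 1/2) * t"
  have z: "z = of_real (cmod z) * cis t"
    using rcis_cmod_Arg[of z] by (simp add: t_def rcis_def)
  have "mv_Re_half_power n z = {0} \<longleftrightarrow> cos x = 0"
    using False by (auto simp: mv_Re_half_power_def Let_def t_def x_def)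
  also have "\<dots> \<longleftrightarrow> cis (2 * x) = -1"
  proof
    assume "cos x = 0"
    then show "cis (2 * x) = -1"
      by (simp add: complex_eq_iff cos_double_cos sin_double)
  next
    assume "cis (2 * x) = -1"
    then have "cos (2 * x) = -1"
      by (simp add: complex_eq_iff)
    then show "cos x = 0"
      by (simp add: cos_double_cos)
  qed
  also have "cis (2 * x) = cis t ^ (2*n+1)"
    unfolding Complex.DeMoivre by (rule arg_cong[where f = cis]) (simp add: x_def field_simps)
  also have "cis t ^ (2*n+1) = -1 \<longleftrightarrow> (\<exists>k\<in>{1..2*n+1}. cis t = cis (zero_angle n k))"
    by (rule cis_power_eq_minus_one_iff)
  also have "\<dots> \<longleftrightarrow> (\<exists>k\<in>{1..2*n+1}. z = of_real (cmod z) * cis (zero_angle n k))"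
  proof -
    have "z = of_real (cmod z) * w \<longleftrightarrow> cis t = w" for w
      using False by (subst z) simp
    then show ?thesis
      by simp
  qed
  finally show ?thesis .
qed

lemma half_power_zero_set:
  assumes "r > 0"
  shows "{z \<in> ball 0 r. mv_Re_half_power n z = {0}} =
    (\<Union>k\<in>{1..2*n+1}. (\<lambda>t. of_real (r * t) * cis (zero_angle n k)) ` {0..<1})"
proof (intro equalityI subsetI)
  fix z assume "z \<in> {z \<in> ball 0 r. mv_Re_half_power n z = {0}}"
  then obtain k where k: "k \<in> {1..2*n+1}" "z = of_real (cmod z) * cis (zero_angle n k)"
    and "cmod z < r"
    by (auto simp: half_power_zero_iff)
  then have "z = of_real (r * (cmod z / r)) * cis (zero_angle n k)" "cmod z / r \<in> {0..<1}"
    using assms by auto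
  then show "z \<in> (\<Union>k\<in>{1..2*n+1}. (\<lambda>t. of_real (r * t) * cis (zero_angle n k)) ` {0..<1})"
    using k(1) by blast
next
  fix z assume "z \<in> (\<Union>k\<in>{1..2*n+1}. (\<lambda>t. of_real (r * t) * cis (zero_angle n k)) ` {0..<1})"
  then obtain k t where kt: "k \<in> {1..2*n+1}" "t \<in> {0..<1}"
      "z = of_real (r * t) * cis (zero_angle n k)"
    by blast
  then have "cmod z = r * t"
    using assms by (simp add: norm_mult)
  then show "z \<in> {z \<in> ball 0 r. mv_Re_half_power n z = {0}}"
    using kt assms by (auto simp: half_power_zero_iff)
qed

section \<open>Angles between images of rays\<close>

text \<open>Multiplication by \<open>d\<close>, the derivative of a conformal map, is a rotation followed by a dilation:
  the inner product is multiplied by \<open>\<bar>d\<bar>\<^sup>2\<close>, as is the product of the norms.\<close>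

lemma arccos_inner_rotated:
  assumes "d \<noteq> 0" "0 \<le> s" "s \<le> pi"
  shows "arccos (((d * cis a) \<bullet> (d * cis (a + s))) /
    (norm (d * cis a) * norm (d * cis (a + s)))) = s"
proof -
  have "(d * cis a) \<bullet> (d * cis (a + s)) = Re (d * cis a * cnj (d * cis (a + s)))"
    by (simp only: inner_complex_def times_complex.sel cnj.sel)
  also have "d * cis a * cnj (d * cis (a + s)) = (d * cnj d) * cis (- s)"
    by (simp add: cis_cnj cis_mult mult_ac)
  also have "Re \<dots> = (cmod d)\<^sup>2 * cos s"
    by (simp flip: complex_norm_square of_real_power add: Re_complex_of_real)
  finally have "(d * cis a) \<bullet> (d * cis (a + s)) = (cmod d)\<^sup>2 * cos s" .
  then show ?thesis
    using assms by (simp add: norm_mult power2_eq_square arccos_cos)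
qed

lemma has_vector_derivative_image_of_ray:
  assumes "f holomorphic_on ball 0 r" "r > 0"
  shows "((\<lambda>t. f (of_real (r * t) * u)) has_vector_derivative deriv f 0 * of_real r * u)
    (at 0 within T)"
proof -
  have g: "((\<lambda>t. of_real (r * t) * u) has_vector_derivative of_real r * u) (at 0 within T)"
    by (auto intro!: derivative_eq_intros simp: has_vector_derivative_def scaleR_conv_of_real mult_ac)
  have "(f has_field_derivative deriv f 0) (at 0)"
    using assms by (auto intro: holomorphic_derivI)
  then have "(f has_field_derivative deriv f 0)
      (at (of_real (r * 0) * u) within (\<lambda>t. of_real (r * t) * u) ` T)"
    by (simp add: has_field_derivative_at_within)
  from field_vector_diff_chain_within[OF g this] show ?thesis
    by (simp add: o_def mult_ac)
qed

section \<open>Transport by the coordinate\<close>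

theorem theorem1p5:
  fixes \<Omega> V :: "complex set" and \<mu> :: signed_measure
    and h \<theta> :: "complex \<Rightarrow> real" and z\<^sub>0 :: complex
    and H :: "complex \<Rightarrow> real set" and n :: nat and r :: real
    and \<Phi> :: "complex \<Rightarrow> complex"
  assumes "open \<Omega>" and "bounded \<Omega>"
    and "radon \<Omega> \<mu>" and "in_H_minus1 \<Omega> \<mu>"
    and "stationary_harmonic \<Omega> h" and "continuous_on \<Omega> h"
    and "distr_laplacian_eq \<Omega> h \<mu>"
    and "z\<^sub>0 \<in> supp \<Omega> \<mu>" and "hopf_odd_zero \<Omega> h z\<^sub>0" and "h z\<^sub>0 = 0"
    and "open V" and "z\<^sub>0 \<in> V" and "V \<subseteq> \<Omega>"
    and "multivalued_harmonic V z\<^sub>0 H" and "abs_single_valued_on V H"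
    and "\<forall>z\<in>V. \<theta> z \<in> {1, -1}" and "\<forall>z\<in>V. h z = \<theta> z * mv_abs H z"
    and "n \<ge> 1" and "r > 0"
    and "biholomorphism \<Phi> (ball 0 r) V" and "\<Phi> 0 = z\<^sub>0"
    and "\<forall>z\<in>ball 0 r. H (\<Phi> z) = mv_Re_half_power n z"
  shows "\<exists>\<gamma> :: nat \<Rightarrow> real \<Rightarrow> complex.
    (\<forall>k\<in>{1..2*n+1}. real_analytic_on (\<gamma> k) {0..<1} \<and> \<gamma> k ` {0..<1} \<subseteq> V \<and> \<gamma> k 0 = z\<^sub>0) \<and>
    {z \<in> V. H z = {0}} = (\<Union>k\<in>{1..2*n+1}. \<gamma> k ` {0..<1}) \<and>
    \<gamma> (2*n+2) = \<gamma> 1 \<and>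
    (\<forall>k\<in>{1..2*n+1}. has_angle (\<gamma> k) (\<gamma> (k+1)) (2 * pi / real (2*n+1))) \<and>
    (\<exists>\<phi>. analytic_diffeomorphism \<phi> V (ball 0 1) \<and>
      (\<forall>k\<in>{1..2*n+1}. \<forall>t\<in>{0..<1}.
         \<phi> (\<gamma> k t) = of_real t *
           exp (\<i> * of_real (pi / real (2*n+1) + 2 * (real k - 1) * pi / real (2*n+1)))))"
proof -
  let ?N = "2*n+1"
  define u where "u k = cis (zero_angle n k)" for k
  define \<gamma> where "\<gamma> k t = \<Phi> (of_real (r * t) * u k)" for k t
  define \<Psi> where "\<Psi> = inv_into (ball 0 r) \<Phi>"
  define \<phi> where "\<phi> w = \<Psi> w / of_real r" for w
  note r = \<open>r > 0\<close>
  have hol: "\<Phi> holomorphic_on ball 0 r" and bij: "bij_betw \<Phi> (ball 0 r) V"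
    and hol\<Psi>: "\<Psi> holomorphic_on V"
    using \<open>biholomorphism \<Phi> (ball 0 r) V\<close> by (auto simp: biholomorphism_def \<Psi>_def)
  have \<Psi>\<Phi>: "\<Psi> (\<Phi> z) = z" if "z \<in> ball 0 r" for z
    using that bij by (simp add: \<Psi>_def bij_betw_inv_into_left)
  have bij\<Psi>: "bij_betw \<Psi> V (ball 0 r)"
    unfolding \<Psi>_def using bij by (rule bij_betw_inv_into)
  have ray: "of_real (r * t) * u k \<in> ball 0 r" if "t \<in> {0..<1}" for t k
    using that r by (simp add: u_def norm_mult)

  have curve: "real_analytic_on (\<gamma> k) {0..<1} \<and> \<gamma> k ` {0..<1} \<subseteq> V \<and> \<gamma> k 0 = z\<^sub>0" for k
  proof (intro conjI)
    have "(\<lambda>w. \<Phi> (of_real r * w * u k)) holomorphic_on ball 0 1"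
    proof (rule holomorphic_on_compose_gen[OF _ hol, unfolded o_def])
      show "(\<lambda>w. of_real r * w * u k) ` ball 0 1 \<subseteq> ball 0 r"
        using r by (auto simp: u_def norm_mult)
    qed (intro holomorphic_intros)
    from real_analytic_on_of_real[OF this, of "{0..<1}"]
    show "real_analytic_on (\<gamma> k) {0..<1}"
      by (auto simp: \<gamma>_def[abs_def] image_subset_iff)
    show "\<gamma> k ` {0..<1} \<subseteq> V"
      using ray bij_betw_imp_surj_on[OF bij] by (auto simp: \<gamma>_def)
    show "\<gamma> k 0 = z\<^sub>0"
      using \<open>\<Phi> 0 = z\<^sub>0\<close> by (simp add: \<gamma>_def)
  qed

  have "{z \<in> V. H z = {0}} = \<Phi> ` {z \<in> ball 0 r. mv_Re_half_power n z = {0}}"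
    using \<open>\<forall>z\<in>ball 0 r. H (\<Phi> z) = mv_Re_half_power n z\<close> bij_betw_imp_surj_on[OF bij]
    by force
  then have zeros: "{z \<in> V. H z = {0}} = (\<Union>k\<in>{1..?N}. \<gamma> k ` {0..<1})"
    unfolding half_power_zero_set[OF r] by (simp add: \<gamma>_def[abs_def] u_def image_UN image_image)

  have periodic: "\<gamma> (2*n+2) = \<gamma> 1"
    using cis_zero_angle_periodic[of n 1] by (simp add: \<gamma>_def[abs_def] u_def)

  have angle: "has_angle (\<gamma> k) (\<gamma> (k+1)) (2 * pi / real ?N)" for k
    unfolding has_angle_def
  proof (intro conjI exI)
    let ?d = "deriv \<Phi> 0 * of_real r"
    have "deriv \<Phi> 0 \<noteq> 0"
      using holomorphic_injective_imp_regular[OF hol, of 0] bij r by (auto simp: bij_betw_def)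
    then have d: "?d \<noteq> 0"
      using r by simp
    show "\<gamma> k 0 = \<gamma> (k+1) 0"
      by (simp add: \<gamma>_def)
    show "(\<gamma> k has_vector_derivative ?d * u k) (at 0 within {0..<1})"
      and "(\<gamma> (k+1) has_vector_derivative ?d * u (k+1)) (at 0 within {0..<1})"
      unfolding \<gamma>_def[abs_def] by (rule has_vector_derivative_image_of_ray[OF hol r])+
    show "?d * u k \<noteq> 0" "?d * u (k+1) \<noteq> 0"
      using d by (auto simp: u_def)
    \<comment> \<open>The tangents enclose the angle \<open>2 pi / (2n+1)\<close> itself, not its complement in the full
      circle, because \<open>n \<ge> 1\<close> makes it at most \<open>pi\<close>.\<close>
    have "2 * pi / real ?N \<le> pi"
      using \<open>n \<ge> 1\<close> by (simp add: field_simps)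
    then show "2 * pi / real ?N = arccos (((?d * u k) \<bullet> (?d * u (k+1))) /
        (norm (?d * u k) * norm (?d * u (k+1))))"
      unfolding u_def zero_angle_Suc using d by (intro arccos_inner_rotated[symmetric]) auto
  qed

  have diffeo: "analytic_diffeomorphism \<phi> V (ball 0 1)"
    unfolding analytic_diffeomorphism_def
  proof (intro conjI)
    have "\<phi> holomorphic_on V"
      unfolding \<phi>_def using hol\<Psi> r by (intro holomorphic_intros) auto
    then show "real_analytic_on \<phi> V"
      using \<open>open V\<close> by (rule holomorphic_on_imp_real_analytic_on)
    have "bij_betw (\<lambda>z. z / of_real r) (ball (0::complex) r) (ball 0 1)"
      by (rule bij_betw_byWitness[where f' = "\<lambda>z. of_real r * z"])
        (use r in \<open>auto simp: norm_divide norm_mult\<close>)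
    from bij_betw_trans[OF bij\<Psi> this] show bij\<phi>: "bij_betw \<phi> V (ball 0 1)"
      by (simp add: \<phi>_def[abs_def] o_def)
    have "inv_into V \<phi> w = \<Phi> (of_real r * w)" if "w \<in> ball 0 1" for w
    proof -
      have *: "of_real r * w \<in> ball 0 r"
        using that r by (simp add: norm_mult)
      then have "\<Phi> (of_real r * w) \<in> V" "\<phi> (\<Phi> (of_real r * w)) = w"
        using bij_betw_imp_surj_on[OF bij] r by (auto simp: \<phi>_def \<Psi>\<Phi>)
      then show ?thesis
        using bij\<phi> by (metis bij_betw_imp_inj_on inv_into_f_f)
    qed
    moreover have "(\<lambda>w. \<Phi> (of_real r * w)) holomorphic_on ball 0 1"
    proof (rule holomorphic_on_compose_gen[OF _ hol, unfolded o_def])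
      show "(\<lambda>w. complex_of_real r * w) ` ball 0 1 \<subseteq> ball 0 r"
        using r by (auto simp: norm_mult)
    qed (intro holomorphic_intros)
    ultimately have "inv_into V \<phi> holomorphic_on ball 0 1"
      by (subst holomorphic_cong[OF refl]) auto
    then show "real_analytic_on (inv_into V \<phi>) (ball 0 1)"
      by (intro holomorphic_on_imp_real_analytic_on) auto
  qed

  have straight: "\<phi> (\<gamma> k t) = of_real t *
      exp (\<i> * of_real (pi / real ?N + 2 * (real k - 1) * pi / real ?N))" if "t \<in> {0..<1}" for k t
  proof -
    have "\<phi> (\<gamma> k t) = of_real t * u k"
      using \<Psi>\<Phi>[OF ray[OF that]] r by (simp add: \<phi>_def \<gamma>_def)
    then show ?thesis
      by (simp only: u_def cis_conv_exp zero_angle_def)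
  qed

  show ?thesis
    by (intro exI[where x = \<gamma>] exI[where x = \<phi>] conjI ballI
        zeros periodic angle diffeo straight curve[THEN conjunct1]
        curve[THEN conjunct2, THEN conjunct1] curve[THEN conjunct2, THEN conjunct2])
qed

end
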